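(* Let $\alpha\in\mathbb{R}$, $\alpha\neq 0$, and let $(x_n)_{n\geq 0}$ be the (unique) real sequence with $x_0=1$ and $-1<x_n<1$ for all $n\geq 1$ that satisfies the discrete Painlevé II equation \[ x_{n+1}+x_{n-1} = \frac{\alpha\, n\, x_n}{1-x_n^2}, \qquad n\geq 1. \] Then \[ |x_n| \leq \frac{2^n}{|\alpha|^n}\,\frac{1}{(2n-1)!!} = \frac{4^n}{|\alpha|^n}\,\frac{n!}{(2n)!}, \qquad n\geq 0. \]
   Context: The double factorial is $(2n-1)!!=(2n-1)(2n-3)\cdots 3\cdot 1$ for $n\geq 1$, with $(-1)!!=1$. *)

theory Defs
  imports Complex_Main
begin

(* odd_double_fact n is (2n-1)!! = (2n-1)(2n-3)...3.1; the empty product gives (-1)!! = 1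
   for n = 0.  The natural-number subtraction never truncates, since k \<ge> 1. *)
definition odd_double_fact :: "nat \<Rightarrow> nat" where
  "odd_double_fact n = (\<Prod>k = 1..n. 2 * k - 1)"

end

theory Submission
  imports Defs
begin

text \<open>
  Put \<open>t = 2 / \<bar>\<alpha>\<bar>\<close>. The sequence \<open>\<bar>x n\<bar>\<close> tends to 0 and satisfies the linear inequality
  \<open>2 n / t * \<bar>x n\<bar> \<le> \<bar>x (n - 1)\<bar> + \<bar>x (n + 1)\<bar>\<close>, so by a discrete maximum principle it is dominated,
  beyond any \<open>n\<^sub>0 \<ge> \<lfloor>t\<rfloor>\<close>, by every nonnegative solution \<open>B\<close> of the reverse inequality that
  dominates it at \<open>n\<^sub>0\<close>. The claimed bound \<open>t ^ n / (2 n - 1)!!\<close> is such a \<open>B\<close> only where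
  \<open>t\<^sup>2 \<le> 2 n + 1\<close>. In the range \<open>t < n \<le> (t\<^sup>2 + 1) / 2\<close> one uses instead
  \<open>B n = exp (- (n * a - t * sinh a))\<close> with \<open>t * cosh a = n\<close>. This is \<open>exp\<close> of minus the integral of
  \<open>arcosh (s / t)\<close> over \<open>t \<le> s \<le> n\<close>, the WKB approximation of the Bessel function \<open>J n t\<close>,
  which solves the linear recurrence. It is at most \<open>t ^ n / (2 n - 1)!!\<close> in that range because
  \<open>(2 n - 1)!! \<le> (2 n - 1) ^ n * exp (- (n - 1))\<close>.
\<close>

section \<open>Comparison for the linear three-term inequality\<close>

lemma discrete_maximum_principle:
  fixes y B c :: "nat \<Rightarrow> real"
  assumes y0: "y \<longlonglongrightarrow> 0" and B0: "\<And>n. B n \<ge> 0" and start: "y m \<le> B m"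
    and c: "\<And>n. n \<ge> m \<Longrightarrow> c (Suc n) > 2"
    and y: "\<And>n. n \<ge> m \<Longrightarrow> c (Suc n) * y (Suc n) \<le> y n + y (Suc (Suc n))"
    and B: "\<And>n. n \<ge> m \<Longrightarrow> B n + B (Suc (Suc n)) \<le> c (Suc n) * B (Suc n)"
    and "n \<ge> m"
  shows "y n \<le> B n"
proof (rule ccontr)
  assume neg: "\<not> y n \<le> B n"
  \<comment> \<open>A positive value of \<open>d\<close> forces a positive maximum at some
    \<open>j > m\<close>. There \<open>c j * d j\<close> is at most the sum of the two neighbours,
    hence at most \<open>2 * d j\<close>, against \<open>c j > 2\<close>.\<close>
  define d where "d k = y k - B k" for k
  have dn: "d n > 0" using neg by (simp add: d_def)
  obtain K where K: "\<And>k. k \<ge> K \<Longrightarrow> y k < d n"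
    using order_tendstoD(2)[OF y0 dn] by (auto simp: eventually_sequentially)
  \<comment> \<open>Beyond \<open>K\<close> nothing can exceed \<open>d n\<close>, since
    \<open>B\<close> is nonnegative; so the maximum over the finite set \<open>S\<close> is the
    maximum over all indices from \<open>m\<close> on.\<close>
  define S where "S = {m..max n K}"
  have "finite (d ` S)" "d ` S \<noteq> {}" using \<open>n \<ge> m\<close> by (auto simp: S_def)
  then obtain j where j: "j \<in> S" "d j = Max (d ` S)"
    using Max_in by (metis (no_types, lifting) imageE)
  have jS: "d k \<le> d j" if "k \<in> S" for k
    using that \<open>finite (d ` S)\<close> by (simp add: j(2))
  have jn: "d n \<le> d j" using \<open>n \<ge> m\<close> by (intro jS) (auto simp: S_def)
  have jmax: "d k \<le> d j" if "k \<ge> m" for k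
  proof (cases "k \<in> S")
    case False
    then have "y k < d n" using that by (intro K) (auto simp: S_def)
    then show ?thesis using B0[of k] jn by (simp add: d_def)
  qed (rule jS)
  have "j \<noteq> m" using start jn dn by (auto simp: d_def)
  with j(1) obtain i where i: "j = Suc i" "i \<ge> m"
    by (cases j) (auto simp: S_def)
  have "2 * d j < c j * d j"
    using c[OF i(2)] jn dn i(1) by simp
  also have "\<dots> \<le> d i + d (Suc (Suc i))"
    using y[OF i(2)] B[OF i(2)] by (simp add: d_def i(1) algebra_simps)
  also have "\<dots> \<le> 2 * d j"
    using jmax[of i] jmax[of "Suc (Suc i)"] i(2) by simp
  finally show False by simp
qed

section \<open>Double factorials and their exponential upper bounds\<close>

lemma odd_double_fact_Suc: "odd_double_fact (Suc n) = (2 * n + 1) * odd_double_fact n"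
  by (simp add: odd_double_fact_def mult.commute)

lemma odd_double_fact_pos: "odd_double_fact n > 0"
  by (induction n) (auto simp: odd_double_fact_Suc odd_double_fact_def[of 0])

lemma odd_double_fact_eq_fact:
  "odd_double_fact n * (2 ^ n * fact n) = (fact (2 * n) :: nat)"
proof (induction n)
  case (Suc n)
  have "odd_double_fact (Suc n) * (2 ^ Suc n * fact (Suc n))
      = (2 * n + 2) * (2 * n + 1) * (odd_double_fact n * (2 ^ n * fact n))"
    by (simp add: odd_double_fact_Suc algebra_simps)
  also have "\<dots> = fact (2 * Suc n)"
    unfolding Suc.IH by (simp add: algebra_simps)
  finally show ?case .
qed (simp add: odd_double_fact_def)

lemma ln_ratio_ge:
  fixes s :: real
  assumes "0 \<le> s" "s < 1"
  shows "2 * s \<le> ln ((1 + s) / (1 - s))"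
proof -
  define h where "h u = ln (1 + u) - ln (1 - u) - 2 * u" for u :: real
  have "h 0 \<le> h s"
  proof (rule DERIV_nonneg_imp_nondecreasing[OF assms(1)])
    fix u assume u: "0 \<le> u" "u \<le> s"
    have "u\<^sup>2 < 1" using u assms by (simp add: abs_square_less_1)
    have "(h has_real_derivative 1 / (1 + u) + 1 / (1 - u) - 2) (at u)"
      unfolding h_def using u assms by (auto intro!: derivative_eq_intros)
    moreover have "1 / (1 + u) + 1 / (1 - u) - 2 = 2 * u\<^sup>2 / (1 - u\<^sup>2)"
      using u assms \<open>u\<^sup>2 < 1\<close> by (simp add: divide_simps) (simp add: power2_eq_square algebra_simps)
    ultimately show "\<exists>d. (h has_real_derivative d) (at u) \<and> 0 \<le> d"
      using \<open>u\<^sup>2 < 1\<close> by (intro exI conjI) auto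
  qed
  then show ?thesis using assms by (simp add: h_def ln_div)
qed

text \<open>The induction step reduces to
  \<open>(n + 1) * ln ((2 * n + 3) / (2 * n + 1)) \<ge> 1\<close>.\<close>

lemma ln_odd_double_fact_le:
  "ln (real (odd_double_fact (Suc n))) \<le> real (Suc n) * ln (2 * real n + 1) - real n"
proof (induction n)
  case 0
  then show ?case by (simp add: odd_double_fact_def)
next
  case (Suc n)
  \<comment> \<open>Chosen so that \<open>(1 + s) / (1 - s)\<close> is the ratio of consecutive odd
    numbers, while \<open>2 * s = 1 / (n + 1)\<close>.\<close>
  define s where "s = 1 / (2 * real n + 2)"
  have "1 + s = (2 * real n + 3) / (2 * real n + 2)" "1 - s = (2 * real n + 1) / (2 * real n + 2)"
    by (simp_all add: s_def field_simps)
  then have "(1 + s) / (1 - s) = (2 * real n + 3) / (2 * real n + 1)"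
    by simp
  then have "2 * s \<le> ln ((2 * real n + 3) / (2 * real n + 1))"
    using ln_ratio_ge[of s] by (simp add: s_def)
  then have "1 \<le> (n + 1) * (ln (2 * real n + 3) - ln (2 * real n + 1))"
    by (simp add: s_def ln_div field_simps)
  moreover have "ln (real (odd_double_fact (Suc (Suc n))))
      = ln (2 * real n + 3) + ln (real (odd_double_fact (Suc n)))"
  proof -
    have "real (odd_double_fact (Suc (Suc n))) = (2 * real n + 3) * real (odd_double_fact (Suc n))"
      by (subst odd_double_fact_Suc) (simp add: algebra_simps)
    then show ?thesis
      using odd_double_fact_pos[of "Suc n"] by (simp only: ln_mult) (simp add: ln_mult_pos)
  qed
  ultimately show ?case using Suc.IH by (simp add: algebra_simps)
qed

text \<open>The right-hand side decreases in \<open>w \<ge> 0\<close>, as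
  \<open>n * ln (n + w) - w\<close> has derivative \<open>n / (n + w) - 1\<close>; the extreme case
  \<open>w = n - 1\<close> is the preceding lemma. The decrease is obtained from
  \<open>ln r \<le> r - 1\<close>.\<close>

lemma odd_double_fact_le:
  fixes w :: real
  assumes "n \<ge> 1" "0 \<le> w" "w \<le> real n - 1"
  shows "real (odd_double_fact n) \<le> (real n + w) ^ n * exp (- w)"
proof -
  obtain k where k: "n = Suc k" using assms(1) by (cases n) auto
  define r where "r = (2 * real k + 1) / (real n + w)"
  have pos: "real n + w > 0" using assms by simp
  have "real n * ln r \<le> real n * (r - 1)"
    using pos by (intro mult_left_mono ln_le_minus_one) (auto simp: r_def)
  also have "\<dots> = real n / (real n + w) * (real k - w)"
    using pos by (simp add: r_def k field_simps)
  also have "\<dots> \<le> 1 * (real k - w)"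
    using assms k pos by (intro mult_right_mono) (auto simp: field_simps)
  finally have "real n * (ln (2 * real k + 1) - ln (real n + w)) \<le> real k - w"
    using pos by (simp add: r_def ln_div)
  then have "ln (real (odd_double_fact n)) \<le> real n * ln (real n + w) - w"
    using ln_odd_double_fact_le[of k] by (simp add: k algebra_simps)
  then have "exp (ln (real (odd_double_fact n))) \<le> exp (real n * ln (real n + w) - w)"
    by simp
  also have "\<dots> = (real n + w) ^ n * exp (- w)"
    using pos by (simp add: exp_diff exp_minus exp_of_nat_mult field_simps)
  finally show ?thesis using odd_double_fact_pos[of n] by simp
qed

section \<open>The WKB comparison function\<close>

lemma sinh_diff_le:
  fixes a b :: real
  assumes "0 \<le> a" "0 \<le> b"
  shows "sinh b - sinh a \<le> cosh b * (b - a)"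
proof -
  have D: "(sinh has_real_derivative cosh u) (at u)" for u :: real
    by (auto intro!: derivative_eq_intros)
  \<comment> \<open>Both cases are the tangent-line inequality at \<open>b\<close> for
    \<open>sinh\<close>, which is convex on the nonnegative reals.\<close>
  show ?thesis
  proof (cases a b rule: linorder_cases)
    case less
    then obtain z where z: "a < z" "z < b" "sinh b - sinh a = (b - a) * cosh z"
      using MVT2[OF less, of sinh cosh] D by blast
    have "cosh z \<le> cosh b" using z assms by (subst cosh_real_nonneg_le_iff) auto
    then show ?thesis using z less by (simp add: mult.commute mult_left_mono)
  next
    case greater
    then obtain z where z: "b < z" "z < a" "sinh a - sinh b = (a - b) * cosh z"
      using MVT2[OF greater, of sinh cosh] D by blast
    have "cosh b \<le> cosh z" using z assms by (subst cosh_real_nonneg_le_iff) auto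
    then have "(a - b) * cosh b \<le> (a - b) * cosh z" using greater by (intro mult_left_mono) auto
    then show ?thesis using z by (simp add: algebra_simps)
  qed simp
qed

text \<open>Clamping at 1 continues the angle by 0, hence \<open>wkb\<close> by 1, below the turning
  point \<open>n = t\<close>. The recurrence at the first index above \<open>t\<close> reaches back
  into that range.\<close>

definition wkb_angle :: "real \<Rightarrow> nat \<Rightarrow> real" where
  "wkb_angle t n = arcosh (max 1 (real n / t))"

definition wkb :: "real \<Rightarrow> nat \<Rightarrow> real" where
  "wkb t n = exp (- t * (wkb_angle t n * cosh (wkb_angle t n) - sinh (wkb_angle t n)))"

lemma wkb_angle_nonneg: "wkb_angle t n \<ge> 0"
  by (simp add: wkb_angle_def)

lemma cosh_wkb_angle: "t > 0 \<Longrightarrow> t * cosh (wkb_angle t n) = max t (real n)"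
  by (simp add: wkb_angle_def max_def field_simps)

lemma wkb_eq_one: "t > 0 \<Longrightarrow> real n \<le> t \<Longrightarrow> wkb t n = 1"
  by (simp add: wkb_def wkb_angle_def max_def field_simps)

text \<open>
  The exponent is a convex function of \<open>n\<close> with slope \<open>wkb_angle t n\<close>; hence the two neighbours of
  \<open>wkb t n\<close> are at most \<open>exp (\<plusminus> wkb_angle t n) * wkb t n\<close>, and these factors add up to
  \<open>2 * cosh (wkb_angle t n)\<close>.
\<close>
lemma wkb_le:
  assumes "t > 0"
  shows "wkb t k \<le> exp (- wkb_angle t n * (max t (real k) - max t (real n))) * wkb t n"
proof -
  define a b where "a = wkb_angle t n" and "b = wkb_angle t k"
  have "t * (sinh b - sinh a) \<le> t * (cosh b * (b - a))"
    using assms by (intro mult_left_mono sinh_diff_le) (auto simp: a_def b_def wkb_angle_nonneg)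
  then have "- t * (b * cosh b - sinh b) \<le> - a * (t * cosh b - t * cosh a) + - t * (a * cosh a - sinh a)"
    by (simp add: algebra_simps)
  then show ?thesis
    using assms unfolding wkb_def exp_add[symmetric] a_def b_def by (simp add: cosh_wkb_angle)
qed

lemma wkb_supersolution:
  assumes "t > 0" "real (Suc n) > t"
  shows "wkb t n + wkb t (Suc (Suc n)) \<le> 2 * real (Suc n) / t * wkb t (Suc n)"
proof -
  define a where "a = wkb_angle t (Suc n)"
  \<comment> \<open>If \<open>n < t\<close>, the clamped step from \<open>n\<close> to
    \<open>Suc n\<close> is shorter than 1, so only an inequality holds.\<close>
  have "- a * (max t (real n) - max t (real (Suc n))) \<le> a"
  proof -
    have "a * (max t (real (Suc n)) - max t (real n)) \<le> a * 1"
      using assms(2) by (intro mult_left_mono) (auto simp: a_def wkb_angle_nonneg)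
    then show ?thesis by (simp add: algebra_simps)
  qed
  then have "wkb t n \<le> exp a * wkb t (Suc n)"
    using wkb_le[OF assms(1), of n "Suc n"]
    by (smt (verit) a_def exp_le_cancel_iff mult_right_mono exp_ge_zero wkb_def)
  moreover have "wkb t (Suc (Suc n)) \<le> exp (- a) * wkb t (Suc n)"
    using wkb_le[OF assms(1), of "Suc (Suc n)" "Suc n"] assms(2) by (simp add: a_def max_def)
  moreover have "exp a + exp (- a) = 2 * real (Suc n) / t"
    using cosh_wkb_angle[OF assms(1), of "Suc n"] assms
    by (simp add: a_def cosh_def field_simps)
  ultimately show ?thesis by (metis add_mono distrib_right)
qed

text \<open>With \<open>w = t * sinh a\<close>, so that
  \<open>w\<^sup>2 = n\<^sup>2 - t\<^sup>2\<close>, \<open>wkb t n\<close> equals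
  \<open>t ^ n\<close> divided by \<open>(n + w) ^ n * exp (- w)\<close>. The last hypothesis says
  exactly that \<open>w \<le> n - 1\<close>, the range of \<open>odd_double_fact_le\<close>.\<close>

lemma wkb_le_bound:
  assumes "t > 0" "n \<ge> 1" "real n > t" "2 * real n - 1 \<le> t\<^sup>2"
  shows "wkb t n \<le> t ^ n / real (odd_double_fact n)"
proof -
  define a where "a = wkb_angle t n"
  define w where "w = t * sinh a"
  have c: "t * cosh a = n"
    using cosh_wkb_angle[OF assms(1), of n] assms(3) by (simp add: a_def)
  have w0: "w \<ge> 0" using assms(1) by (simp add: w_def a_def wkb_angle_nonneg)
  have "w\<^sup>2 = (t * cosh a)\<^sup>2 - t\<^sup>2"
    by (simp add: w_def power_mult_distrib cosh_square_eq algebra_simps)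
  also have "\<dots> \<le> (real n - 1)\<^sup>2"
    using assms(4) by (simp add: c power2_eq_square algebra_simps)
  finally have w1: "w \<le> real n - 1"
    by (rule power2_le_imp_le) (use assms(2) in simp)
  have ea: "real n + w = t * exp a"
    by (simp add: c[symmetric] w_def distrib_left[symmetric] cosh_plus_sinh)
  have "wkb t n = exp (- (real n * a - w))"
    by (simp add: wkb_def a_def[symmetric] w_def c[symmetric] algebra_simps)
  then have "wkb t n * ((real n + w) ^ n * exp (- w)) = t ^ n"
    by (simp add: ea power_mult_distrib exp_of_nat_mult[symmetric] exp_add[symmetric])
  moreover have "wkb t n * real (odd_double_fact n) \<le> wkb t n * ((real n + w) ^ n * exp (- w))"
    using odd_double_fact_le[OF assms(2) w0 w1] by (intro mult_left_mono) (auto simp: wkb_def)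
  ultimately show ?thesis using odd_double_fact_pos[of n] by (simp add: field_simps)
qed

section \<open>The claimed bound as a comparison function\<close>

lemma one_le_bound:
  assumes "real n \<le> t"
  shows "1 \<le> t ^ n / real (odd_double_fact n)"
proof (cases n)
  case 0
  then show ?thesis by (simp add: odd_double_fact_def)
next
  case (Suc k)
  have "real (odd_double_fact n) \<le> real n ^ n"
    using odd_double_fact_le[of n 0] Suc by simp
  also have "\<dots> \<le> t ^ n" using assms by (intro power_mono) auto
  finally show ?thesis using odd_double_fact_pos[of n] by simp
qed

text \<open>Since \<open>b n\<close> is \<open>(2 * n + 1) / t * b (Suc n)\<close>, a share
  \<open>1 / t * b (Suc n)\<close> of the right-hand side is left for
  \<open>b (Suc (Suc n))\<close>, which is \<open>t / (2 * n + 3) * b (Suc n)\<close>.\<close>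

lemma bound_supersolution:
  assumes "t > 0" "t\<^sup>2 \<le> 2 * real n + 3"
  defines "b \<equiv> \<lambda>n. t ^ n / real (odd_double_fact n)"
  shows "b n + b (Suc (Suc n)) \<le> 2 * real (Suc n) / t * b (Suc n)"
proof -
  have "real (odd_double_fact (Suc k)) = (2 * real k + 1) * real (odd_double_fact k)" for k
    by (simp add: odd_double_fact_Suc algebra_simps)
  then have step: "b (Suc k) = t / (2 * real k + 1) * b k" for k
    by (simp add: b_def)
  have 1: "b n = (2 * real n + 1) / t * b (Suc n)"
    using assms(1) by (simp add: step add_nonneg_eq_0_iff)
  have 2: "b (Suc (Suc n)) = t / (2 * real n + 3) * b (Suc n)"
    by (subst step) (simp add: add.commute)
  have "t / (2 * real n + 3) \<le> 1 / t"
    using assms by (simp add: field_simps power2_eq_square)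
  then have "t / (2 * real n + 3) * b (Suc n) \<le> 1 / t * b (Suc n)"
    using assms(1) by (intro mult_right_mono) (auto simp: b_def)
  moreover have "2 * real (Suc n) / t * b (Suc n)
      = (2 * real n + 1) / t * b (Suc n) + 1 / t * b (Suc n)"
    unfolding distrib_right[symmetric] add_divide_distrib[symmetric] by simp
  ultimately show ?thesis using 1 2 by linarith
qed

section \<open>Gluing the two comparisons\<close>

lemma subsolution_bound:
  fixes y :: "nat \<Rightarrow> real"
  assumes t: "t > 0" and y1: "\<And>n. y n \<le> 1" and y0: "y \<longlonglongrightarrow> 0"
    and y: "\<And>n. 2 * real (Suc n) / t * y (Suc n) \<le> y n + y (Suc (Suc n))"
  shows "y n \<le> t ^ n / real (odd_double_fact n)"
proof -
  define m where "m = nat \<lfloor>t\<rfloor>"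
  define c where "c n = 2 * real n / t" for n
  have m: "real m \<le> t" "t < real m + 1"
    using t unfolding m_def by linarith+
  have c2: "c (Suc k) > 2" if "k \<ge> m" for k
    using that m t by (simp add: c_def field_simps)
  have y_wkb: "y k \<le> wkb t k" if "k \<ge> m" for k
  proof (rule discrete_maximum_principle[where m = m and c = c])
    show "y m \<le> wkb t m" using y1 wkb_eq_one[OF t m(1)] by simp
    show "wkb t n + wkb t (Suc (Suc n)) \<le> c (Suc n) * wkb t (Suc n)" if "n \<ge> m" for n
      using wkb_supersolution[OF t, of n] m that by (simp add: c_def)
  qed (use y0 y c2 that in \<open>auto simp: c_def wkb_def\<close>)
  have early: "y k \<le> t ^ k / real (odd_double_fact k)" if "2 * real k - 1 \<le> t\<^sup>2" for k
  proof (cases "real k \<le> t")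
    case True
    then show ?thesis using one_le_bound[OF True] y1[of k] by linarith
  next
    case False
    then have "k \<ge> m" "k \<ge> 1" using m t by linarith+
    then show ?thesis
      using y_wkb[of k] wkb_le_bound[OF t, of k] False that by linarith
  qed
  \<comment> \<open>\<open>M\<close> is the last index that \<open>early\<close> covers, and
    \<open>t\<^sup>2 < 2 * M + 1\<close> already makes the claimed bound a supersolution from
    \<open>M\<close> on.\<close>
  define z where "z = (t\<^sup>2 + 1) / 2"
  define M where "M = nat \<lfloor>z\<rfloor>"
  have "z \<ge> 0" by (simp add: z_def)
  then have "real M \<le> z" "z < real M + 1"
    unfolding M_def by linarith+
  then have M: "2 * real M - 1 \<le> t\<^sup>2" "t\<^sup>2 < 2 * real M + 1"
    by (simp_all add: z_def field_simps)
  \<comment> \<open>From \<open>(t - 1)\<^sup>2 \<ge> 0\<close>; the resulting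
    \<open>m \<le> M\<close> carries \<open>c > 2\<close> over to the second comparison.\<close>
  have "real m * 2 \<le> t\<^sup>2 + 1"
    using m(1) zero_le_power2[of "t - 1"] by (simp add: power2_eq_square algebra_simps)
  then have "m \<le> M"
    using M(2) by linarith
  show ?thesis
  proof (cases "n \<ge> M")
    case True
    show ?thesis
    proof (rule discrete_maximum_principle[where m = M and c = c and y = y])
      show "t ^ k / real (odd_double_fact k) + t ^ Suc (Suc k) / real (odd_double_fact (Suc (Suc k)))
          \<le> c (Suc k) * (t ^ Suc k / real (odd_double_fact (Suc k)))" if "k \<ge> M" for k
        using bound_supersolution[OF t, of k] M(2) that by (simp add: c_def)
    qed (use y0 y c2 early M True t \<open>m \<le> M\<close> in \<open>auto simp: c_def\<close>)
  next
    case False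
    then show ?thesis using M(1) by (intro early) linarith
  qed
qed

section \<open>From the Painleve recurrence to the linear inequality\<close>

theorem theorem2:
  fixes \<alpha> :: real and x :: "nat \<Rightarrow> real"
  assumes "\<alpha> \<noteq> 0"
    and "x 0 = 1"
    and "\<And>n. n \<ge> 1 \<Longrightarrow> - 1 < x n \<and> x n < 1"
    and "\<And>n. n \<ge> 1 \<Longrightarrow> x (n + 1) + x (n - 1) = \<alpha> * real n * x n / (1 - (x n)\<^sup>2)"
  shows "\<forall>n. \<bar>x n\<bar> \<le> 2 ^ n / \<bar>\<alpha>\<bar> ^ n * (1 / real (odd_double_fact n))
           \<and> 2 ^ n / \<bar>\<alpha>\<bar> ^ n * (1 / real (odd_double_fact n))
             = 4 ^ n / \<bar>\<alpha>\<bar> ^ n * (fact n / fact (2 * n))"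
proof (intro allI conjI)
  fix n
  define t where "t = 2 / \<bar>\<alpha>\<bar>"
  have t: "t > 0" using assms(1) by (simp add: t_def)
  have x1: "\<bar>x k\<bar> \<le> 1" for k
    using assms(2) assms(3)[of k] by (cases "k = 0") auto
  \<comment> \<open>The denominator \<open>1 - x\<^sup>2\<close> lies in (0, 1], so dropping it only
    decreases the absolute value: the nonlinearity helps.\<close>
  have rec: "2 * real (Suc k) / t * \<bar>x (Suc k)\<bar> \<le> \<bar>x k\<bar> + \<bar>x (Suc (Suc k))\<bar>" for k
  proof -
    have q: "0 < 1 - (x (Suc k))\<^sup>2" "1 - (x (Suc k))\<^sup>2 \<le> 1"
      using assms(3)[of "Suc k"] by (auto simp: abs_square_less_1)
    have "2 * real (Suc k) / t * \<bar>x (Suc k)\<bar> = \<bar>\<alpha> * real (Suc k) * x (Suc k)\<bar>"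
      by (simp add: t_def abs_mult)
    also have "\<dots> \<le> \<bar>\<alpha> * real (Suc k) * x (Suc k)\<bar> / (1 - (x (Suc k))\<^sup>2)"
      using q by (simp add: le_divide_eq mult_left_le)
    also have "\<dots> = \<bar>x (Suc (Suc k)) + x k\<bar>"
      using assms(4)[of "Suc k"] q by simp
    finally show ?thesis by linarith
  qed
  \<comment> \<open>Decay comes from boundedness alone: the right-hand side of \<open>rec\<close> is
    at most 2, while its coefficient grows linearly.\<close>
  have "(\<lambda>k. \<bar>x (Suc k)\<bar>) \<longlonglongrightarrow> 0"
  proof (rule tendsto_sandwich[OF _ _ tendsto_const])
    have "\<bar>x (Suc k)\<bar> \<le> t * inverse (real (Suc k))" for k
    proof -
      have "2 * real (Suc k) / t * \<bar>x (Suc k)\<bar> \<le> 2"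
        using rec[of k] x1[of k] x1[of "Suc (Suc k)"] by linarith
      then show ?thesis using t by (simp add: field_simps)
    qed
    then show "\<forall>\<^sub>F k in sequentially. \<bar>x (Suc k)\<bar> \<le> t * inverse (real (Suc k))" by simp
    show "(\<lambda>k. t * inverse (real (Suc k))) \<longlonglongrightarrow> 0"
      by (rule tendsto_mult_right_zero[OF LIMSEQ_inverse_real_of_nat])
  qed auto
  then have "(\<lambda>k. \<bar>x k\<bar>) \<longlonglongrightarrow> 0"
    by (rule LIMSEQ_imp_Suc)
  then have "\<bar>x n\<bar> \<le> t ^ n / real (odd_double_fact n)"
    using t x1 rec by (intro subsolution_bound) auto
  then show "\<bar>x n\<bar> \<le> 2 ^ n / \<bar>\<alpha>\<bar> ^ n * (1 / real (odd_double_fact n))"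
    by (simp add: t_def power_divide)
next
  fix n
  have "real (odd_double_fact n) * (2 ^ n * fact n) = fact (2 * n)"
    using arg_cong[OF odd_double_fact_eq_fact[of n], of real] by simp
  moreover have "(4 :: real) ^ n = 2 ^ n * 2 ^ n"
    by (simp add: power_mult_distrib[symmetric])
  ultimately show "2 ^ n / \<bar>\<alpha>\<bar> ^ n * (1 / real (odd_double_fact n))
      = 4 ^ n / \<bar>\<alpha>\<bar> ^ n * (fact n / fact (2 * n))"
    using odd_double_fact_pos[of n] assms(1)
    by (simp add: field_simps)
qed

end
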